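(* (i) For every $n\ge 1$, if $\mathcal F=\{f_1,\dots,f_k\}$ is a Parseval frame for $\mathbb Z_2^n$, then $$\sum_{j=1}^k (x,f_j)^2=(x,x)\qquad\text{for all }x\in\mathbb Z_2^n .$$ (ii) In general the converse does not hold: there exist $n\ge1$ and a family $\{f_1,\dots,f_k\}$ of vectors in $\mathbb Z_2^n$ such that $\sum_{j=1}^k (x,f_j)^2=(x,x)$ for all $x\in\mathbb Z_2^n$, but $\{f_1,\dots,f_k\}$ is not a Parseval frame for $\mathbb Z_2^n$.
   Context: $\mathbb Z_2$ is the field with two elements. The dot product $(\cdot,\cdot):\mathbb Z_2^n\times\mathbb Z_2^n\to\mathbb Z_2$ is the bilinear map $(a,b)=\sum_{i=1}^n a_ib_i$ (sum in $\mathbb Z_2$). A family (finite indexed list, repetitions allowed) $\{f_1,\dots,f_k\}$ of vectors in $\mathbb Z_2^n$ is a Parseval frame for $\mathbb Z_2^n$ if $x=\sum_{j=1}^k (x,f_j)f_j$ for all $x\in\mathbb Z_2^n$. *)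

theory Defs
  imports "HOL-Library.Z2" "Jordan_Normal_Form.Matrix"
begin

text \<open>
  \<open>\<int>\<^sub>2\<close> is the field \<^typ>\<open>bit\<close>; \<open>\<int>\<^sub>2\<^sup>n\<close> is the carrier \<open>carrier_vec n\<close> of \<^typ>\<open>bit vec\<close>, so that
  the dimension is an ordinary natural number and can be existentially quantified.
  A family \<open>f\<^sub>1, \<dots>, f\<^sub>k\<close> is the restriction of a function on \<^typ>\<open>nat\<close> to \<open>{1..k}\<close>;
  values outside this index set are irrelevant.
\<close>

definition vec_family :: "nat \<Rightarrow> nat \<Rightarrow> (nat \<Rightarrow> bit vec) \<Rightarrow> bool" where
  "vec_family n k f \<longleftrightarrow> (\<forall>j\<in>{1..k}. f j \<in> carrier_vec n)"

definition parseval_frame :: "nat \<Rightarrow> nat \<Rightarrow> (nat \<Rightarrow> bit vec) \<Rightarrow> bool" where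
  "parseval_frame n k f \<longleftrightarrow> vec_family n k f \<and>
     (\<forall>x\<in>carrier_vec n.
        x = finsum_vec TYPE(bit) n (\<lambda>j. (x \<bullet> f j) \<cdot>\<^sub>v f j) {1..k})"

end

theory Submission
  imports Defs "Jordan_Normal_Form.VS_Connect"
begin

text \<open>Pair the reconstruction formula for \<open>x\<close> with \<open>x\<close> itself:
  linearity in the first argument leaves the terms
  \<open>(x \<bullet> f j) * (f j \<bullet> x)\<close>, and symmetry makes each one a
  square.\<close>

lemma parseval_frame_sum_square:
  assumes "parseval_frame n k f" and x: "x \<in> carrier_vec n"
  shows "(\<Sum>j=1..k. (x \<bullet> f j)\<^sup>2) = x \<bullet> x"
proof -
  have f: "f j \<in> carrier_vec n" if "j \<in> {1..k}" for j
    using assms(1) that unfolding parseval_frame_def vec_family_def by blast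
  let ?g = "\<lambda>j. (x \<bullet> f j) \<cdot>\<^sub>v f j"
  have g: "?g \<in> {1..k} \<rightarrow> carrier_vec n"
    using f by (intro Pi_I smult_carrier_vec[THEN iffD2])
  have "x = finsum_vec TYPE(bit) n ?g {1..k}"
    using assms unfolding parseval_frame_def by blast
  then have "x \<bullet> x = finsum_vec TYPE(bit) n ?g {1..k} \<bullet> x"
    by (rule arg_cong)
  also have "\<dots> = (\<Sum>j=1..k. ?g j \<bullet> x)"
    \<comment> \<open>\<open>finsum_vec\<close> is rewritten as the \<open>finsum\<close> of the
      vector space, the form in which the scalar product is known to distribute over sums.\<close>
    unfolding vec_space.finsum_vec by (rule vec_space.finsum_scalar_prod_sum[OF g x])
  also have "\<dots> = (\<Sum>j=1..k. (x \<bullet> f j)\<^sup>2)"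
  proof (rule sum.cong[OF refl])
    fix j assume "j \<in> {1..k}"
    then show "?g j \<bullet> x = (x \<bullet> f j)\<^sup>2"
      using smult_scalar_prod_distrib[OF f x] comm_scalar_prod[OF x f]
      by (simp only: power2_eq_square)
  qed
  finally show ?thesis by (rule sym)
qed

text \<open>
  In characteristic 2, \<open>(x, x) = x\<^sub>1 + x\<^sub>2 = (x, (1, 1))\<close>, so the single vector \<open>(1, 1)\<close> preserves
  \<open>(x, x)\<close> without spanning.
\<close>

lemma sum_square_not_parseval_frame:
  defines "f \<equiv> \<lambda>_::nat. vec 2 (\<lambda>_. 1::bit)"
  shows "vec_family 2 1 f"
    and "\<And>x. x \<in> carrier_vec 2 \<Longrightarrow> (\<Sum>j=1..1. (x \<bullet> f j)\<^sup>2) = x \<bullet> x"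
    and "\<not> parseval_frame 2 1 f"
proof -
  show "vec_family 2 1 f"
    by (simp add: vec_family_def f_def)
  show "(\<Sum>j=1..1. (x \<bullet> f j)\<^sup>2) = x \<bullet> x" if "x \<in> carrier_vec 2" for x
    using that
    \<comment> \<open>Both sides depend only on two bits, which leaves four cases;
      \<open>numeral_2_eq_2\<close> lets the index range \<open>{0..<2}\<close> unfold.\<close>
    by (cases "x $ 0"; cases "x $ 1") (simp_all add: f_def scalar_prod_def numeral_2_eq_2)
  show "\<not> parseval_frame 2 1 f"
  proof
    \<comment> \<open>Indices start at 0, so \<open>?e\<close> is (1, 0). Its product with (1, 1) is
      1, so reconstruction would return (1, 1), which differs from \<open>?e\<close> at index
      1.\<close>
    let ?e = "unit_vec 2 0 :: bit vec"
    let ?g = "\<lambda>j. (?e \<bullet> f j) \<cdot>\<^sub>v f j"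
    assume "parseval_frame 2 1 f"
    moreover have "?e \<in> carrier_vec 2"
      by simp
    ultimately have "?e = finsum_vec TYPE(bit) 2 ?g {1..1}"
      unfolding parseval_frame_def by blast
    then have "?e $ 1 = finsum_vec TYPE(bit) 2 ?g {1..1} $ 1"
      by (rule arg_cong)
    also have "\<dots> = (\<Sum>j\<in>{1..1}. ?g j $ 1)"
      by (rule index_finsum_vec) (simp_all add: f_def)
    finally show False
      by (simp add: f_def)
  qed
qed

theorem proposition3p2:
  "(\<forall>n\<ge>1. \<forall>k f. parseval_frame n k f \<longrightarrow>
      (\<forall>x\<in>carrier_vec n. (\<Sum>j=1..k. (x \<bullet> f j)\<^sup>2) = x \<bullet> x))
   \<and> (\<exists>n\<ge>1. \<exists>k f. vec_family n k f \<and>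
      (\<forall>x\<in>carrier_vec n. (\<Sum>j=1..k. (x \<bullet> f j)\<^sup>2) = x \<bullet> x) \<and>
      \<not> parseval_frame n k f)"
proof (intro conjI allI impI ballI)
  show "\<exists>n\<ge>1. \<exists>k f. vec_family n k f \<and>
      (\<forall>x\<in>carrier_vec n. (\<Sum>j=1..k. (x \<bullet> f j)\<^sup>2) = x \<bullet> x) \<and>
      \<not> parseval_frame n k f"
    \<comment> \<open>The witnesses are n = 2 and k = 1; \<open>one_le_numeral\<close> supplies 1
      \<le> 2.\<close>
    using sum_square_not_parseval_frame one_le_numeral by blast
qed (rule parseval_frame_sum_square)

end
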